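(* Let $n, M\ge 1$ be integers with $n\ge 2M$, let $X_1,\dots,X_n$ be i.i.d. random variables with values in a measurable space $\mathcal{Z}$, let $h:\mathcal{Z}\times\mathcal{Z}\to\mathbb{R}$ be a measurable kernel with $\mathbb{E}|h(X_1,X_2)|<\infty$, put $\theta(h)=\mathbb{E}[h(X_1,X_2)]$, and let $\varepsilon>0$. Let $\Lambda_n=\{(i,j):1\le i<j\le n\}$ and $$\widehat W_n^\varepsilon=\frac{1}{|\Lambda_n^M|}\sum_{\mathbf{J}\in\Lambda_n^M}\mathbf{1}\left\{\left|\widehat U_{M,\mathbf{J}}(h)-\theta(h)\right|\ge\varepsilon\right\},\qquad \widehat U_{M,\mathbf{J}}(h)=\frac1M\sum_{(i,j)\in\mathbf{J}}h(X_i,X_j),$$ and let $\widehat q_\varepsilon=\mathbb{E}[\widehat W_n^\varepsilon]$. Then for all $t>0$, $$\mathbb{P}\left(\widehat W_n^\varepsilon-\widehat q_\varepsilon\ge t\right)\le\exp\left(-\frac{nt^2}{2M}\right).$$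
   Context: $\Lambda_n^M$ is the $M$-fold Cartesian power of $\Lambda_n$, i.e. the set of all length-$M$ sequences $\mathbf{J}$ of pairs from $\Lambda_n$, with repetitions allowed. The sum $\sum_{(i,j)\in\mathbf{J}}$ runs over the $M$ entries of the sequence, counted with multiplicity. *)

theory Defs
  imports "HOL-Probability.Probability"
begin

definition index_pairs :: "nat \<Rightarrow> (nat \<times> nat) set" where
  "index_pairs n = {(i, j). 1 \<le> i \<and> i < j \<and> j \<le> n}"

text \<open>The Cartesian power of \<^term>\<open>index_pairs n\<close>, with sequences of pairs represented as lists.\<close>

definition pair_sequences :: "nat \<Rightarrow> nat \<Rightarrow> (nat \<times> nat) list set" where
  "pair_sequences n M = {J. set J \<subseteq> index_pairs n \<and> length J = M}"

definition theta ::
  "'w measure \<Rightarrow> (nat \<Rightarrow> 'w \<Rightarrow> 'z) \<Rightarrow> ('z \<times> 'z \<Rightarrow> real) \<Rightarrow> real" where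
  "theta P X h = prob_space.expectation P (\<lambda>\<omega>. h (X 1 \<omega>, X 2 \<omega>))"

definition U_hat ::
  "(nat \<Rightarrow> 'w \<Rightarrow> 'z) \<Rightarrow> ('z \<times> 'z \<Rightarrow> real) \<Rightarrow> nat \<Rightarrow> (nat \<times> nat) list \<Rightarrow> 'w \<Rightarrow> real" where
  "U_hat X h M J \<omega> = 1 / real M * (\<Sum>(i, j)\<leftarrow>J. h (X i \<omega>, X j \<omega>))"

definition W_hat ::
  "'w measure \<Rightarrow> (nat \<Rightarrow> 'w \<Rightarrow> 'z) \<Rightarrow> ('z \<times> 'z \<Rightarrow> real) \<Rightarrow> nat \<Rightarrow> nat \<Rightarrow> real \<Rightarrow> 'w \<Rightarrow> real" where
  "W_hat P X h n M \<epsilon> \<omega> =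
     1 / real (card (pair_sequences n M)) *
     (\<Sum>J\<in>pair_sequences n M. of_bool (\<bar>U_hat X h M J \<omega> - theta P X h\<bar> \<ge> \<epsilon>))"

definition q_hat ::
  "'w measure \<Rightarrow> (nat \<Rightarrow> 'w \<Rightarrow> 'z) \<Rightarrow> ('z \<times> 'z \<Rightarrow> real) \<Rightarrow> nat \<Rightarrow> nat \<Rightarrow> real \<Rightarrow> real" where
  "q_hat P X h n M \<epsilon> = prob_space.expectation P (W_hat P X h n M \<epsilon>)"

end

theory Submission
  imports Defs
begin

text \<open>
  This is Hoeffding's argument for U-statistics. The symmetric group acts on the sequences of pairs
  by relabelling the indices and re-sorting each pair, so no symmetry of \<open>h\<close> is needed.
  A sequence involves at most \<open>2M\<close> indices, hence every sequence has \<open>k = n div (2M)\<close> relabelled copies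
  with pairwise disjoint index sets, and these stay disjoint under a further common relabelling.
  Averaging over all relabellings writes \<^const>\<open>W_hat\<close> as a convex combination of averages of \<open>k\<close>
  independent indicators. By Jensen's inequality, its moment generating function obeys the bound
  of Hoeffding's lemma for such averages, so the tail is at most \<open>exp (- 2kt\<^sup>2)\<close>, and
  \<open>k \<ge> n / (4M)\<close>.
\<close>

section \<open>Permutations with prescribed images\<close>

text \<open>The complements of \<open>S\<close> and \<open>B\<close> in \<open>A\<close> also have
  equal size, so a bijection between the sets and one between the complements glue to a
  permutation.\<close>

lemma permutes_mapping_set_onto:
  assumes "finite A" "S \<subseteq> A" "B \<subseteq> A" "card S = card B"
  obtains p where "p permutes A" "p ` S = B"
proof -
  have fin: "finite S" "finite B"
    using assms finite_subset by blast+
  obtain f where f: "bij_betw f S B"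
    using finite_same_card_bij[OF fin assms(4)] by blast
  have "card (A - S) = card (A - B)"
    using assms fin by (simp add: card_Diff_subset)
  then obtain g where g: "bij_betw g (A - S) (A - B)"
    using finite_same_card_bij[of "A - S" "A - B"] finite_Diff[OF assms(1)] by blast
  define p where "p x = (if x \<in> S then f x else if x \<in> A then g x else x)" for x
  have "bij_betw p S B"
    using f bij_betw_cong[of S p f B] by (simp add: p_def)
  moreover have "bij_betw p (A - S) (A - B)"
    using g bij_betw_cong[of "A - S" p g "A - B"] by (simp add: p_def)
  ultimately have "bij_betw p (S \<union> (A - S)) (B \<union> (A - B))"
    by (rule bij_betw_combine) blast
  then have "bij_betw p A A"
    using assms by (simp add: Un_absorb1)
  then have "p permutes A"
    by (rule bij_imp_permutes) (use assms(2) in \<open>auto simp: p_def\<close>)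
  moreover have "p ` S = B"
    using \<open>bij_betw p S B\<close> by (simp add: bij_betw_def)
  ultimately show thesis
    by (rule that)
qed

text \<open>Since \<open>k * m \<le> n\<close>, the range \<open>{1..n}\<close> contains
  \<open>k\<close> consecutive blocks of length \<open>m\<close>, and \<open>S\<close> is moved into
  a different block by each permutation.\<close>

lemma permutations_with_disjoint_images:
  fixes S :: "nat set"
  assumes "S \<subseteq> {1..n}" "card S \<le> m" "k * m \<le> n"
  obtains \<tau> where "\<And>b. b < k \<Longrightarrow> \<tau> b permutes {1..n}"
    "disjoint_family_on (\<lambda>b. \<tau> b ` S) {..<k}"
proof -
  \<comment> \<open>The first \<open>card S\<close> elements of block number \<open>b\<close>;
    blocks are counted from 0, but indices from 1, hence the \<open>+ 1\<close>.\<close>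
  define B where "B b = {b * m + 1..b * m + card S}" for b
  have B_sub: "B b \<subseteq> {b * m + 1..Suc b * m}" for b
    using assms(2) by (auto simp: B_def)
  have "\<exists>p. p permutes {1..n} \<and> p ` S = B b" if "b < k" for b
  proof -
    have "Suc b * m \<le> k * m"
      using that by (intro mult_right_mono) auto
    with B_sub[of b] assms(3) have "B b \<subseteq> {1..n}"
      by fastforce
    moreover have "card S = card (B b)"
      by (simp add: B_def)
    ultimately obtain p where "p permutes {1..n}" "p ` S = B b"
      by (rule permutes_mapping_set_onto[OF finite_atLeastAtMost assms(1)])
    then show ?thesis
      by blast
  qed
  then obtain \<tau> where \<tau>: "\<And>b. b < k \<Longrightarrow> \<tau> b permutes {1..n} \<and> \<tau> b ` S = B b"
    by metis
  have B_less: "B b \<inter> B c = {}" if "b < c" for b c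
  proof -
    have "Suc b * m \<le> c * m"
      using that by (intro mult_right_mono) auto
    then show ?thesis
      using B_sub[of b] B_sub[of c] by fastforce
  qed
  have "disjoint_family_on (\<lambda>b. \<tau> b ` S) {..<k}"
    unfolding disjoint_family_on_def
  proof (intro ballI impI)
    fix b c assume "b \<in> {..<k}" "c \<in> {..<k}" "b \<noteq> c"
    then show "\<tau> b ` S \<inter> \<tau> c ` S = {}"
      using \<tau>[of b] \<tau>[of c] B_less[of b c] B_less[of c b]
      by (cases b c rule: linorder_cases) auto
  qed
  with \<tau> show thesis
    using that by blast
qed

section \<open>Relabelling of pair sequences\<close>

text \<open>\<open>min\<close> and \<open>max\<close> restore the increasing order that
  \<open>index_pairs\<close> demands and that a permutation may reverse.\<close>

definition relabel_pair :: "(nat \<Rightarrow> nat) \<Rightarrow> nat \<times> nat \<Rightarrow> nat \<times> nat" where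
  "relabel_pair p = (\<lambda>(i, j). (min (p i) (p j), max (p i) (p j)))"

definition indices :: "(nat \<times> nat) list \<Rightarrow> nat set" where
  "indices J = (\<Union>(i, j)\<in>set J. {i, j})"

lemma finite_indices [simp]: "finite (indices J)"
  by (auto simp: indices_def)

lemma card_indices_le: "card (indices J) \<le> 2 * length J"
proof (induction J)
  case (Cons x J)
  have "card (indices (x # J)) \<le> card {fst x, snd x} + card (indices J)"
    by (rule order_trans[OF _ card_Un_le]) (auto simp: indices_def split: prod.split)
  also have "card {fst x, snd x} \<le> 2"
    by (simp add: card_insert_if)
  finally show ?case
    using Cons.IH by simp
qed (simp add: indices_def)

text \<open>Sorting a pair keeps its underlying set. Thus disjointness of index sets can be
  controlled through \<open>p\<close> alone.\<close>

lemma indices_map_relabel_pair: "indices (map (relabel_pair p) J) = p ` indices J"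
proof -
  have "{min (p i) (p j), max (p i) (p j)} = {p i, p j}" for i j
    by (auto simp: min_def max_def)
  then show ?thesis
    by (simp add: indices_def relabel_pair_def image_UN case_prod_unfold)
qed

lemma indices_subset_if_pair_sequence:
  "J \<in> pair_sequences n M \<Longrightarrow> indices J \<subseteq> {1..n}"
  by (fastforce simp: indices_def pair_sequences_def index_pairs_def)

lemma finite_index_pairs: "finite (index_pairs n)"
  by (rule finite_subset[of _ "{..n} \<times> {..n}"]) (auto simp: index_pairs_def)

lemma finite_pair_sequences [simp]: "finite (pair_sequences n M)"
  unfolding pair_sequences_def by (rule finite_lists_length_eq[OF finite_index_pairs])

lemma pair_sequences_nonempty:
  assumes "n \<ge> 2"
  shows "pair_sequences n M \<noteq> {}"
proof -
  have "replicate M (1, 2) \<in> pair_sequences n M"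
    using assms by (auto simp: pair_sequences_def index_pairs_def)
  then show ?thesis
    by blast
qed

lemma relabel_pair_in_index_pairs:
  assumes "p permutes {1..n}" "x \<in> index_pairs n"
  shows "relabel_pair p x \<in> index_pairs n"
proof -
  obtain i j where x: "x = (i, j)" "i \<in> {1..n}" "j \<in> {1..n}" "i \<noteq> j"
    using assms(2) by (auto simp: index_pairs_def)
  have "p i \<in> {1..n}" "p j \<in> {1..n}" "p i \<noteq> p j"
    using x assms(1) permutes_in_image[OF assms(1)] permutes_inj[OF assms(1)]
    by (auto dest: injD)
  then show ?thesis
    by (auto simp: x relabel_pair_def index_pairs_def min_def max_def)
qed

text \<open>An increasing pair is determined by its underlying two-element set, and an injective
  \<open>p\<close> is injective on sets.\<close>

lemma inj_on_relabel_pair: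
  assumes "inj p"
  shows "inj_on (relabel_pair p) (index_pairs n)"
proof (rule inj_onI)
  fix x y assume xy: "x \<in> index_pairs n" "y \<in> index_pairs n" "relabel_pair p x = relabel_pair p y"
  obtain i j i' j' where eq: "x = (i, j)" "y = (i', j')"
    by fastforce
  have "p ` {i, j} = p ` {i', j'}"
    using xy(3) by (auto simp: eq relabel_pair_def min_def max_def split: if_splits)
  then have "{i, j} = {i', j'}"
    using assms by (simp only: inj_image_eq_iff)
  then show "x = y"
    using xy(1,2) by (auto simp: eq index_pairs_def doubleton_eq_iff)
qed

text \<open>An injective map of a finite set into itself is onto.\<close>

lemma bij_betw_map_relabel_pair:
  assumes "p permutes {1..n}"
  shows "bij_betw (map (relabel_pair p)) (pair_sequences n M) (pair_sequences n M)"
proof -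
  have "inj_on (map (relabel_pair p)) (pair_sequences n M)"
  proof (rule inj_onI)
    fix J K
    assume "J \<in> pair_sequences n M" "K \<in> pair_sequences n M"
      and eq: "map (relabel_pair p) J = map (relabel_pair p) K"
    then have "set J \<union> set K \<subseteq> index_pairs n"
      by (simp add: pair_sequences_def)
    then have "inj_on (relabel_pair p) (set J \<union> set K)"
      using inj_on_relabel_pair permutes_inj[OF assms] inj_on_subset by blast
    with eq show "J = K"
      by (rule map_inj_on)
  qed
  moreover have "map (relabel_pair p) ` pair_sequences n M \<subseteq> pair_sequences n M"
  proof (rule image_subsetI)
    fix J assume "J \<in> pair_sequences n M"
    then have "relabel_pair p ` set J \<subseteq> index_pairs n" "length J = M"
      using relabel_pair_in_index_pairs[OF assms] unfolding pair_sequences_def by blast+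
    then show "map (relabel_pair p) J \<in> pair_sequences n M"
      by (simp add: pair_sequences_def)
  qed
  ultimately show ?thesis
    by (simp add: bij_betw_def endo_inj_surj)
qed

text \<open>For fixed \<open>J\<close> and \<open>b\<close>, composing with
  \<open>\<tau> J b\<close> on the right only reorders the sum over the group \<open>G\<close>, so
  \<open>\<tau>\<close> drops out even though it depends on \<open>J\<close>. For fixed
  \<open>p\<close>, relabelling only reorders the sum over sequences.\<close>

lemma sum_pair_sequences_eq_mean_relabelled:
  fixes f :: "(nat \<times> nat) list \<Rightarrow> real"
  assumes "\<And>J b. J \<in> pair_sequences n M \<Longrightarrow> b < k \<Longrightarrow> \<tau> J b permutes {1..n}"
    and "k > 0"
  defines "G \<equiv> {p. p permutes {1..n}}"
  shows "(\<Sum>(J, p)\<in>pair_sequences n M \<times> G. (\<Sum>b<k. f (map (relabel_pair (p \<circ> \<tau> J b)) J)) / real k)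
    = real (card G) * (\<Sum>J\<in>pair_sequences n M. f J)"
proof -
  have inner: "(\<Sum>p\<in>G. f (map (relabel_pair (p \<circ> \<tau> J b)) J)) = (\<Sum>p\<in>G. f (map (relabel_pair p) J))"
    if "J \<in> pair_sequences n M" "b < k" for J b
    unfolding G_def
    using sum_permutations_compose_right[OF assms(1)[OF that], of "\<lambda>p. f (map (relabel_pair p) J)"]
    by simp
  have "(\<Sum>(J, p)\<in>pair_sequences n M \<times> G. (\<Sum>b<k. f (map (relabel_pair (p \<circ> \<tau> J b)) J)) / real k)
      = (\<Sum>J\<in>pair_sequences n M. (\<Sum>b<k. \<Sum>p\<in>G. f (map (relabel_pair (p \<circ> \<tau> J b)) J)) / real k)"
    by (subst sum.swap)
      (simp add: sum.cartesian_product[symmetric] sum_divide_distrib)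
  also have "\<dots> = (\<Sum>J\<in>pair_sequences n M. (\<Sum>b<k. \<Sum>p\<in>G. f (map (relabel_pair p) J)) / real k)"
    by (rule sum.cong[OF refl], rule arg_cong2[where f = "(/)", OF sum.cong[OF refl] refl],
        rule inner) auto
  \<comment> \<open>The summands no longer depend on \<open>b\<close>, so the \<open>k\<close> equal
    terms cancel the division by \<open>k\<close>.\<close>
  also have "\<dots> = (\<Sum>p\<in>G. \<Sum>J\<in>pair_sequences n M. f (map (relabel_pair p) J))"
    using \<open>k > 0\<close> by (subst sum.swap) simp
  also have "\<dots> = (\<Sum>p\<in>G. \<Sum>J\<in>pair_sequences n M. f J)"
    by (intro sum.cong refl sum.reindex_bij_betw bij_betw_map_relabel_pair) (simp add: G_def)
  finally show ?thesis
    by simp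
qed

section \<open>Exponential moments and tail bounds\<close>

context prob_space
begin

text \<open>Independence factors the exponential moment. Hoeffding's lemma with parameter
  \<open>l / card I\<close> bounds each factor by \<open>exp ((l / card I)\<^sup>2 / 8)\<close>, and
  there are \<open>card I\<close> factors. Using the nonnegative integral avoids integrability
  conditions on the exponentials.\<close>

lemma Hoeffding_mgf_mean:
  fixes Y :: "'b \<Rightarrow> 'a \<Rightarrow> real"
  assumes "finite I" "I \<noteq> {}" and indep: "indep_vars (\<lambda>_. borel) Y I"
    and bounds: "\<And>i x. i \<in> I \<Longrightarrow> Y i x \<in> {0..1}" and "l > 0"
  shows "(\<integral>\<^sup>+x. exp (l * ((\<Sum>i\<in>I. Y i x) / card I - expectation (\<lambda>x. (\<Sum>i\<in>I. Y i x) / card I))) \<partial>M)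
    \<le> ennreal (exp (l\<^sup>2 / (8 * real (card I))))"
proof -
  let ?k = "real (card I)"
  have k: "?k > 0"
    using assms(1,2) by (simp add: card_gt_0_iff)
  interpret Y: indep_interval_bounded_random_variables M I Y "\<lambda>_. 0" "\<lambda>_. 1"
    by unfold_locales (use assms in auto)
  note integrable = interval_bounded_random_variable.integrable[OF Y.bounded_random_variable]
  have "expectation (\<lambda>x. (\<Sum>i\<in>I. Y i x) / ?k) = (\<Sum>i\<in>I. expectation (Y i)) / ?k"
    using integrable by (simp add: Bochner_Integration.integral_sum)
  then have "l * ((\<Sum>i\<in>I. Y i x) / ?k - expectation (\<lambda>x. (\<Sum>i\<in>I. Y i x) / ?k))
      = (\<Sum>i\<in>I. l / ?k * (Y i x - expectation (Y i)))" for x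
    by (simp only: sum_distrib_left[symmetric] sum_subtractf) (simp add: diff_divide_distrib right_diff_distrib)
  then have "(\<integral>\<^sup>+x. exp (l * ((\<Sum>i\<in>I. Y i x) / ?k - expectation (\<lambda>x. (\<Sum>i\<in>I. Y i x) / ?k))) \<partial>M)
      = (\<integral>\<^sup>+x. (\<Prod>i\<in>I. ennreal (exp (l / ?k * (Y i x - expectation (Y i))))) \<partial>M)"
    using assms(1) by (simp only: exp_sum prod_ennreal exp_ge_zero)
  also have "\<dots> = (\<Prod>i\<in>I. \<integral>\<^sup>+x. exp (l / ?k * (Y i x - expectation (Y i))) \<partial>M)"
    by (intro indep_vars_nn_integral assms(1) indep_vars_compose2[OF indep]) auto
  also have "\<dots> \<le> (\<Prod>i\<in>I. ennreal (exp ((l / ?k)\<^sup>2 * (1 - 0)\<^sup>2 / 8)))"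
  proof (intro prod_mono_ennreal)
    fix i assume "i \<in> I"
    then interpret interval_bounded_random_variable M "Y i" 0 1 ..
    show "(\<integral>\<^sup>+x. exp (l / ?k * (Y i x - expectation (Y i))) \<partial>M)
        \<le> ennreal (exp ((l / ?k)\<^sup>2 * (1 - 0)\<^sup>2 / 8))"
      by (rule Hoeffdings_lemma_nn_integral) (use \<open>l > 0\<close> k in auto)
  qed
  also have "\<dots> = ennreal (exp (l\<^sup>2 / (8 * ?k)))"
    using k by (simp add: ennreal_power exp_of_nat_mult[symmetric] power_divide power2_eq_square)
  finally show ?thesis .
qed

text \<open>Chernoff's method for an average of possibly dependent variables: by Jensen's
  inequality, the average inherits the exponential moment bound of its terms. The parameter
  \<open>v\<close> acts as an effective sample size.\<close>

lemma prob_mean_ge_le_if_mgf_le: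
  fixes Y :: "'b \<Rightarrow> 'a \<Rightarrow> real" and v t :: real
  assumes "finite A" "A \<noteq> {}" and integrable: "\<And>a. a \<in> A \<Longrightarrow> integrable M (Y a)"
    and mgf: "\<And>a l. a \<in> A \<Longrightarrow> l > 0 \<Longrightarrow>
      (\<integral>\<^sup>+x. exp (l * (Y a x - expectation (Y a))) \<partial>M) \<le> ennreal (exp (l\<^sup>2 / (8 * v)))"
    and "v > 0" "t > 0"
  defines "Z \<equiv> \<lambda>x. (\<Sum>a\<in>A. Y a x) / card A"
  shows "prob {x \<in> space M. Z x - expectation Z \<ge> t} \<le> exp (- 2 * v * t\<^sup>2)"
proof -
  let ?N = "real (card A)"
  define D where "D a x = Y a x - expectation (Y a)" for a x
  \<comment> \<open>The minimiser of the Chernoff exponent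
    \<open>- l * t + l\<^sup>2 / (8 * v)\<close>, whose minimum is
    \<open>- 2 * v * t\<^sup>2\<close>.\<close>
  define l where "l = 4 * v * t"
  have N: "?N > 0"
    using assms(1,2) by (simp add: card_gt_0_iff)
  have l: "l > 0"
    using \<open>v > 0\<close> \<open>t > 0\<close> by (simp add: l_def)
  have [measurable]: "a \<in> A \<Longrightarrow> Y a \<in> borel_measurable M" for a
    using integrable by blast
  then have [measurable]: "a \<in> A \<Longrightarrow> D a \<in> borel_measurable M" for a
    unfolding D_def by measurable
  have [measurable]: "Z \<in> borel_measurable M"
    unfolding Z_def by measurable
  have "expectation Z = (\<Sum>a\<in>A. expectation (Y a)) / ?N"
    using integrable unfolding Z_def by (simp add: Bochner_Integration.integral_sum)
  then have ZD: "Z x - expectation Z = (\<Sum>a\<in>A. (1 / ?N) *\<^sub>R D a x)" for x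
    by (simp add: Z_def D_def sum_divide_distrib[symmetric] sum_subtractf diff_divide_distrib)
  have "ennreal (prob {x \<in> space M. Z x - expectation Z \<ge> t})
      \<le> ennreal (exp (- l * t)) * (\<integral>\<^sup>+x\<in>space M. exp (l * (Z x - expectation Z)) \<partial>M)"
    unfolding emeasure_eq_measure[symmetric] by (intro Chernoff_ineq_nn_integral_ge l) auto
  also have "(\<integral>\<^sup>+x\<in>space M. exp (l * (Z x - expectation Z)) \<partial>M)
      \<le> (\<integral>\<^sup>+x. (\<Sum>a\<in>A. ennreal (1 / ?N) * ennreal (exp (l * D a x))) \<partial>M)"
  proof (intro nn_integral_mono)
    fix x assume "x \<in> space M"
    \<comment> \<open>Jensen's inequality for the convex exponential with uniform weights.\<close>
    have "exp (l * (\<Sum>a\<in>A. (1 / ?N) *\<^sub>R D a x)) \<le> (\<Sum>a\<in>A. 1 / ?N * exp (l * D a x))"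
      using l N assms(1,2)
      by (intro convex_on_sum[OF assms(1,2) convex_on_exp]) auto
    then show "ennreal (exp (l * (Z x - expectation Z))) * indicator (space M) x
        \<le> (\<Sum>a\<in>A. ennreal (1 / ?N) * ennreal (exp (l * D a x)))"
      using \<open>x \<in> space M\<close> by (simp add: ZD ennreal_mult[symmetric] sum_ennreal ennreal_leI)
  qed
  also have "\<dots> = (\<Sum>a\<in>A. ennreal (1 / ?N) * (\<integral>\<^sup>+x. exp (l * D a x) \<partial>M))"
    by (simp add: nn_integral_sum nn_integral_cmult)
  also have "\<dots> \<le> (\<Sum>a\<in>A. ennreal (1 / ?N) * ennreal (exp (l\<^sup>2 / (8 * v))))"
    unfolding D_def by (intro sum_mono mult_left_mono mgf l) auto
  also have "\<dots> = ennreal (exp (l\<^sup>2 / (8 * v)))"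
    using N by (simp add: ennreal_mult[symmetric] ennreal_of_nat_eq_real_of_nat)
  finally have "prob {x \<in> space M. Z x - expectation Z \<ge> t} \<le> exp (- l * t) * exp (l\<^sup>2 / (8 * v))"
    by (simp add: ennreal_mult[symmetric] mult_left_mono)
  also have "\<dots> = exp (- 2 * v * t\<^sup>2)"
    using \<open>v > 0\<close> by (simp add: exp_add[symmetric] l_def power2_eq_square)
  finally show ?thesis .
qed

end

section \<open>Rounding of the block count, and measurability of kernel sums\<close>

text \<open>With \<open>k = n div (2 * M) \<ge> 1\<close>, the quotient \<open>n / (2 * M)\<close>
  is below \<open>k + 1 \<le> 2 * k\<close>. This converts the exponent
  \<open>2 * k * t\<^sup>2\<close> into the stated one.\<close>

lemma half_quotient_le_div:
  fixes n M :: nat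
  assumes "M \<ge> 1" "n \<ge> 2 * M"
  shows "real n / (2 * real M) \<le> 2 * real (n div (2 * M))"
proof -
  have "n < 2 * M * Suc (n div (2 * M))"
    using assms(1) by (intro dividend_less_times_div[of "2 * M" n, unfolded mult_Suc_right[symmetric]]) auto
  moreover have "n div (2 * M) \<ge> 1"
    using assms by (simp add: div_greater_zero_iff Suc_le_eq)
  then have "2 * M * Suc (n div (2 * M)) \<le> 2 * M * (2 * (n div (2 * M)))"
    by (intro mult_left_mono) auto
  ultimately have "n \<le> 2 * M * (2 * (n div (2 * M)))"
    by linarith
  then have "real n \<le> real (2 * M * (2 * (n div (2 * M))))"
    by (rule of_nat_mono)
  then show ?thesis
    using assms(1) by (simp add: field_simps)
qed

text \<open>The product ranges only over the coordinates in \<open>S\<close>, so that a kernel sum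
  becomes a measurable function of one block of variables, as needed to transfer independence from
  blocks to indicators.\<close>

lemma borel_measurable_sum_list_PiM_pairs:
  fixes h :: "'z \<times> 'z \<Rightarrow> real"
  assumes [measurable]: "h \<in> borel_measurable (Z \<Otimes>\<^sub>M Z)" and "indices J \<subseteq> S"
  shows "(\<lambda>x. \<Sum>(i, j)\<leftarrow>J. h (x i, x j)) \<in> borel_measurable (Pi\<^sub>M S (\<lambda>_. Z))"
  using assms(2)
proof (induction J)
  case (Cons a J)
  obtain i j where a: "a = (i, j)"
    by fastforce
  have [measurable]: "i \<in> S" "j \<in> S" and J: "indices J \<subseteq> S"
    using Cons.prems by (auto simp: a indices_def)
  note [measurable] = Cons.IH[OF J]
  show ?case
    by (simp add: a)
qed simp

lemma sum_list_pairs_restrict: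
  assumes "indices J \<subseteq> S"
  shows "(\<Sum>(i, j)\<leftarrow>J. h (restrict x S i, restrict x S j)) = (\<Sum>(i, j)\<leftarrow>J. h (x i, x j))"
proof (intro arg_cong[where f = sum_list] map_cong refl)
  fix a assume "a \<in> set J"
  then have "fst a \<in> S" "snd a \<in> S"
    using assms by (force simp: indices_def)+
  then show "(case a of (i, j) \<Rightarrow> h (restrict x S i, restrict x S j)) = (case a of (i, j) \<Rightarrow> h (x i, x j))"
    by (simp add: case_prod_unfold)
qed

theorem proposition3p1:
  fixes P :: "'w measure" and Z :: "'z measure"
    and X :: "nat \<Rightarrow> 'w \<Rightarrow> 'z" and h :: "'z \<times> 'z \<Rightarrow> real"
    and n M :: nat and \<epsilon> t :: real
  assumes "prob_space P"
    and "n \<ge> 1" and "M \<ge> 1" and "n \<ge> 2 * M"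
    and indep: "prob_space.indep_vars P (\<lambda>_. Z) X {1..n}"
    and ident: "\<And>i. i \<in> {1..n} \<Longrightarrow> distr P Z (X i) = distr P Z (X 1)"
    and "h \<in> borel_measurable (Z \<Otimes>\<^sub>M Z)"
    and "integrable P (\<lambda>\<omega>. h (X 1 \<omega>, X 2 \<omega>))"
    and "\<epsilon> > 0" and "t > 0"
  shows "prob_space.prob P {\<omega> \<in> space P. W_hat P X h n M \<epsilon> \<omega> - q_hat P X h n M \<epsilon> \<ge> t}
           \<le> exp (- (real n * t\<^sup>2) / (2 * real M))"
proof -
  interpret prob_space P
    by fact
  define k where "k = n div (2 * M)"
  define L where "L = pair_sequences n M"
  define G where "G = {p. p permutes {1..n}}"
  define f where "f J \<omega> = (of_bool (\<bar>U_hat X h M J \<omega> - theta P X h\<bar> \<ge> \<epsilon>) :: real)" for J \<omega>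
  have "k > 0"
    using assms(3,4) by (simp add: k_def div_greater_zero_iff)
  have "\<exists>\<tau>. (\<forall>b<k. \<tau> b permutes {1..n}) \<and> disjoint_family_on (\<lambda>b. \<tau> b ` indices J) {..<k}"
    if "J \<in> L" for J
  proof -
    have "card (indices J) \<le> 2 * M"
      using card_indices_le[of J] that by (simp add: L_def pair_sequences_def)
    moreover have "indices J \<subseteq> {1..n}"
      using that indices_subset_if_pair_sequence by (simp add: L_def)
    moreover have "k * (2 * M) \<le> n"
      by (simp add: k_def)
    ultimately obtain \<tau> where "\<And>b. b < k \<Longrightarrow> \<tau> b permutes {1..n}"
        "disjoint_family_on (\<lambda>b. \<tau> b ` indices J) {..<k}"
      using permutations_with_disjoint_images by blast
    then show ?thesis
      by blast
  qed
  \<comment> \<open>The disjointifying permutations are chosen separately for each sequence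
    \<open>J\<close>.\<close>
  then obtain \<tau> where \<tau>: "\<And>J b. J \<in> L \<Longrightarrow> b < k \<Longrightarrow> \<tau> J b permutes {1..n}"
      and disj: "\<And>J. J \<in> L \<Longrightarrow> disjoint_family_on (\<lambda>b. \<tau> J b ` indices J) {..<k}"
    by metis
  define A where "A = L \<times> G"
  define F where "F a b = f (map (relabel_pair (snd a \<circ> \<tau> (fst a) b)) (fst a))" for a b
  \<comment> \<open>For \<open>a = (J, p)\<close>, the average of the indicators over the
    \<open>k\<close> disjoint copies of \<open>J\<close>, all relabelled further by the common
    \<open>p\<close>.\<close>
  define Y where "Y a \<omega> = (\<Sum>b<k. F a b \<omega>) / real k" for a \<omega>

  have fin: "finite A" and nonempty: "A \<noteq> {}"
    using pair_sequences_nonempty[of n M] assms(3,4) permutes_id[of "{1..n}"]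
    by (auto simp: A_def L_def G_def finite_permutations simp del: permutes_id)
  have card_G: "card G > 0"
    by (simp add: G_def card_permutations[OF refl])

  \<comment> \<open>Hoeffding's representation of \<open>W_hat\<close> as a uniform average of the
    \<open>Y a\<close>; the factor \<open>card G\<close> cancels because
    \<open>card A = card L * card G\<close>.\<close>
  have W: "W_hat P X h n M \<epsilon> = (\<lambda>\<omega>. (\<Sum>a\<in>A. Y a \<omega>) / card A)"
  proof
    fix \<omega>
    have "(\<Sum>a\<in>A. Y a \<omega>) = real (card G) * (\<Sum>J\<in>L. f J \<omega>)"
      using sum_pair_sequences_eq_mean_relabelled[of n M k \<tau> "\<lambda>J. f J \<omega>"] \<tau> \<open>k > 0\<close>
      by (simp add: A_def L_def G_def Y_def F_def case_prod_unfold)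
    then show "W_hat P X h n M \<epsilon> \<omega> = (\<Sum>a\<in>A. Y a \<omega>) / card A"
      using card_G by (simp add: W_hat_def A_def L_def f_def card_cartesian_product)
  qed

  have F_indep: "indep_vars (\<lambda>_. borel) (F a) {..<k}" if "a \<in> A" for a
  proof -
    obtain J p where a: "a = (J, p)"
      by fastforce
    then have J: "J \<in> L" and p: "p permutes {1..n}"
      using that by (simp_all add: A_def G_def)
    define K where "K b = map (relabel_pair (p \<circ> \<tau> J b)) J" for b
    define S where "S b = indices (K b)" for b
    \<comment> \<open>The indicator as a function on the product space, reading only coordinates in
      \<open>S b\<close>.\<close>
    define g where
      "g b x = (of_bool (\<bar>1 / real M * (\<Sum>(i, j)\<leftarrow>K b. h (x i, x j)) - theta P X h\<bar> \<ge> \<epsilon>) :: real)" for b x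
    have S: "S b = p ` \<tau> J b ` indices J" for b
      by (simp only: S_def K_def indices_map_relabel_pair image_comp)
    have "S b \<subseteq> {1..n}" if "b < k" for b
    proof -
      have "\<tau> J b ` indices J \<subseteq> \<tau> J b ` {1..n}"
        using J indices_subset_if_pair_sequence by (intro image_mono) (simp add: L_def)
      then have "p ` \<tau> J b ` indices J \<subseteq> p ` {1..n}"
        using permutes_image[OF \<tau>[OF J that]] by blast
      then show ?thesis
        using permutes_image[OF p] by (simp add: S)
    qed
    \<comment> \<open>The injective \<open>p\<close> preserves the disjointness provided by
      \<open>\<tau> J\<close>.\<close>
    moreover have "disjoint_family_on S {..<k}"
      using disj[OF J] permutes_inj[OF p]
      by (simp add: disjoint_family_on_def S image_Int[symmetric])
    ultimately have "indep_vars (\<lambda>b. Pi\<^sub>M (S b) (\<lambda>_. Z)) (\<lambda>b \<omega>. restrict (\<lambda>i. X i \<omega>) (S b)) {..<k}"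
      by (intro indep_vars_restrict[OF indep]) auto
    moreover have "g b \<in> borel_measurable (Pi\<^sub>M (S b) (\<lambda>_. Z))" for b
    proof -
      note [measurable] = borel_measurable_sum_list_PiM_pairs[OF assms(7), of "K b" "S b"]
      show ?thesis
        unfolding g_def by measurable (simp add: S_def)
    qed
    ultimately have "indep_vars (\<lambda>_. borel) (\<lambda>b \<omega>. g b (restrict (\<lambda>i. X i \<omega>) (S b))) {..<k}"
      by (rule indep_vars_compose2)
    moreover have "g b (restrict (\<lambda>i. X i \<omega>) (S b)) = F a b \<omega>" for b \<omega>
      using sum_list_pairs_restrict[of "K b" "S b" h "\<lambda>i. X i \<omega>"]
      by (simp add: g_def F_def f_def U_hat_def a S_def K_def)
    ultimately show ?thesis
      by simp
  qed

  have Y_integrable: "integrable P (Y a)" if "a \<in> A" for a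
  proof -
    \<comment> \<open>Measurability of the indicators is part of their independence
      statement.\<close>
    have [measurable]: "b < k \<Longrightarrow> F a b \<in> borel_measurable P" for b
      using F_indep[OF that] by (auto simp: indep_vars_def)
    have "integrable P (F a b)" if "b < k" for b
    proof (rule integrable_const_bound)
      show "AE \<omega> in P. norm (F a b \<omega>) \<le> 1"
        by (simp add: F_def f_def)
    qed (use that in measurable)
    then show ?thesis
      unfolding Y_def by (intro integrable_divide Bochner_Integration.integrable_sum) auto
  qed

  have "prob {\<omega> \<in> space P. W_hat P X h n M \<epsilon> \<omega> - q_hat P X h n M \<epsilon> \<ge> t} \<le> exp (- 2 * real k * t\<^sup>2)"
    unfolding q_hat_def W
  proof (rule prob_mean_ge_le_if_mgf_le)
    fix a l assume "a \<in> A" "(l :: real) > 0"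
    then show "(\<integral>\<^sup>+\<omega>. exp (l * (Y a \<omega> - expectation (Y a))) \<partial>P) \<le> ennreal (exp (l\<^sup>2 / (8 * real k)))"
      using Hoeffding_mgf_mean[of "{..<k}" "F a" l] F_indep \<open>k > 0\<close>
      by (simp add: Y_def[abs_def] F_def f_def lessThan_empty_iff)
  qed (use fin nonempty Y_integrable \<open>k > 0\<close> \<open>t > 0\<close> in auto)
  also have "\<dots> \<le> exp (- (real n * t\<^sup>2) / (2 * real M))"
    using mult_right_mono[OF half_quotient_le_div[OF assms(3,4)], of "t\<^sup>2"] by (simp add: k_def)
  finally show ?thesis .
qed

end
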